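(* Let $P$ and $Q$ be lattice paths from $(0,0)$ to $(m,r)$ with steps $E=(1,0)$, $N=(0,1)$, with $P$ never going above $Q$. Then every face of the polytope $\mathcal{P}(\mathcal{M}[P,Q])$ is itself a lattice path matroid polytope, i.e., equals $\mathcal{P}(\mathcal{M}')$ for some matroid $\mathcal{M}'$ on $[m+r]$ which is a lattice path matroid.
   Context: For lattice paths $P,Q$ from $(0,0)$ to $(m,r)$ with $P$ never above $Q$, $\mathcal{M}[P,Q]$ is the matroid on $[m+r]$ whose bases are the $r$-subsets $B$ such that the lattice path with North steps exactly at the positions in $B$ stays in the region bounded by $P$ and $Q$ (equivalently the transversal matroid with presentation $N_i=[l_i,u_i]$, $l_i,u_i$ the positions of the $i$-th North step of $Q$ and $P$). A lattice path matroid is a matroid isomorphic to some $\mathcal{M}[P',Q']$. The matroid polytope is $\mathcal{P}(\mathcal{M})=\mathrm{conv}\{\sum_{i\in B}e_i : B\text{ a basis}\}$. *)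

theory Defs
  imports "HOL-Analysis.Analysis"
begin

datatype step = East | North

text \<open>A path starting at \<open>(0,0)\<close> is given by its sequence of steps.\<close>

definition lattice_path :: "nat \<Rightarrow> nat \<Rightarrow> step list \<Rightarrow> bool" where
  "lattice_path m r p \<longleftrightarrow> count_list p East = m \<and> count_list p North = r"

text \<open>After \<open>k\<close> steps every path lies on the antidiagonal \<open>x + y = k\<close>. So two paths with common
  endpoints can be compared one antidiagonal at a time: \<open>p\<close> never goes above \<open>q\<close> iff on each
  antidiagonal the height of \<open>p\<close> is at most the height of \<open>q\<close>.\<close>

definition never_above :: "step list \<Rightarrow> step list \<Rightarrow> bool" where
  "never_above p q \<longleftrightarrow> (\<forall>k. count_list (take k p) North \<le> count_list (take k q) North)"

definition path_of :: "nat \<Rightarrow> nat set \<Rightarrow> step list" where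
  "path_of n B = map (\<lambda>i. if i \<in> B then North else East) [1..<Suc n]"

text \<open>The bases of \<open>M[P,Q]\<close>; its ground set is \<open>{1..m + r}\<close>.\<close>

definition lpm_bases :: "nat \<Rightarrow> nat \<Rightarrow> step list \<Rightarrow> step list \<Rightarrow> nat set set" where
  "lpm_bases m r P Q =
     {B. B \<subseteq> {1..m + r} \<and> card B = r \<and>
         never_above P (path_of (m + r) B) \<and> never_above (path_of (m + r) B) Q}"

text \<open>Matroids are given by a finite ground set and a set of bases.\<close>

definition matroid :: "'a set \<Rightarrow> 'a set set \<Rightarrow> bool" where
  "matroid E \<B> \<longleftrightarrow> finite E \<and> \<B> \<noteq> {} \<and> (\<forall>B\<in>\<B>. B \<subseteq> E) \<and>
     (\<forall>A\<in>\<B>. \<forall>B\<in>\<B>. \<forall>x\<in>A - B. \<exists>y\<in>B - A. insert y (A - {x}) \<in> \<B>)"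

definition matroid_iso :: "'a set \<Rightarrow> 'a set set \<Rightarrow> 'b set \<Rightarrow> 'b set set \<Rightarrow> bool" where
  "matroid_iso E \<B> E' \<B>' \<longleftrightarrow>
     (\<exists>f. bij_betw f E E' \<and> (\<forall>B. B \<subseteq> E \<longrightarrow> (B \<in> \<B> \<longleftrightarrow> f ` B \<in> \<B>')))"

definition lattice_path_matroid :: "'a set \<Rightarrow> 'a set set \<Rightarrow> bool" where
  "lattice_path_matroid E \<B> \<longleftrightarrow> matroid E \<B> \<and>
     (\<exists>m r P Q. lattice_path m r P \<and> lattice_path m r Q \<and> never_above P Q \<and>
        matroid_iso E \<B> {1..m + r} (lpm_bases m r P Q))"

text \<open>The argument \<open>e\<close> supplies the unit vectors: \<open>e i\<close> is the coordinate vector of the element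
  \<open>i\<close> of the ground set.\<close>

definition matroid_polytope :: "('i \<Rightarrow> 'a::real_vector) \<Rightarrow> 'i set set \<Rightarrow> 'a set" where
  "matroid_polytope e \<B> = convex hull {\<Sum>i\<in>B. e i | B. B \<in> \<B>}"

end

(* Record a set B by its height function k |-> |B \<inter> {1..k}|. The families M[P,Q] are exactly the
   nonempty families of r-sets that contain every r-set whose height function lies pointwise between
   those of two members (P and Q are recovered as pointwise minimum and maximum). Symmetric basis
   exchange for such a family is a discrete intermediate value argument on the difference of two
   height functions.

   Faces are exposed, so a face is the polytope of the bases of maximal weight for some w. For two
   such bases, a symmetric exchange can only swap elements of equal weight; hence maximal bases meet
   each level set of w in equally many elements, and a level of one may be replaced by the same
   level of another. Now sort the ground set by decreasing weight, ties by position. If the sorted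
   height function of C lies between those of two maximal bases A and B, the same holds level by
   level in the original order, and A can be turned into C one level at a time inside the
   maximal bases. So after sorting, the maximal bases again form a lattice path matroid. *)
theory Submission
  imports Defs
begin

section \<open>Height functions of sets and height-convex families\<close>

definition height :: "nat set \<Rightarrow> nat \<Rightarrow> nat" where
  "height B k = card (B \<inter> {..k})"

definition height_convex :: "nat \<Rightarrow> nat \<Rightarrow> nat set set \<Rightarrow> bool" where
  "height_convex n r \<B> \<longleftrightarrow> (\<forall>B\<in>\<B>. B \<subseteq> {1..n} \<and> card B = r) \<and>
     (\<forall>A\<in>\<B>. \<forall>B\<in>\<B>. \<forall>C. C \<subseteq> {1..n} \<longrightarrow> card C = r \<longrightarrow>
        (\<forall>k. min (height A k) (height B k) \<le> height C k \<and>
             height C k \<le> max (height A k) (height B k)) \<longrightarrow> C \<in> \<B>)"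

lemma height_convexD:
  assumes "height_convex n r \<B>" "A \<in> \<B>" "B \<in> \<B>" "C \<subseteq> {1..n}" "card C = r"
    and "\<And>k. min (height A k) (height B k) \<le> height C k"
    and "\<And>k. height C k \<le> max (height A k) (height B k)"
  shows "C \<in> \<B>"
  using assms unfolding height_convex_def by blast

lemma height_convex_basis:
  assumes "height_convex n r \<B>" "B \<in> \<B>"
  shows "B \<subseteq> {1..n}" "card B = r" "finite B"
  using assms finite_subset[of B "{1..n}"] unfolding height_convex_def by auto

lemma height_0: "B \<subseteq> {1..n} \<Longrightarrow> height B 0 = 0"
  by (auto simp: height_def)

lemma height_Suc: "height B (Suc k) = height B k + of_bool (Suc k \<in> B)"
proof -
  have "B \<inter> {..Suc k} = (if Suc k \<in> B then insert (Suc k) (B \<inter> {..k}) else B \<inter> {..k})"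
    by (auto simp: le_Suc_eq)
  then show ?thesis by (simp add: height_def)
qed

lemma height_ge: "B \<subseteq> {1..n} \<Longrightarrow> n \<le> k \<Longrightarrow> height B k = card B"
  unfolding height_def by (rule arg_cong[of _ _ card]) auto

lemma height_union:
  "A \<inter> B = {} \<Longrightarrow> height (A \<union> B) k = height A k + height B k"
  unfolding height_def by (subst card_Un_disjoint[symmetric]) (auto intro: arg_cong[of _ _ card])

text \<open>Stated additively on both sides to avoid truncated subtraction.\<close>

lemma height_swap:
  assumes "x \<in> B" "y \<notin> B"
  shows "height (insert y (B - {x})) k + of_bool (x \<le> k) = height B k + of_bool (y \<le> k)"
proof -
  have 1: "height (B - {x}) k + of_bool (x \<le> k) = height B k"
  proof (cases "x \<le> k")
    case True
    then have "B \<inter> {..k} = insert x ((B - {x}) \<inter> {..k})" using assms by auto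
    then show ?thesis using True by (simp add: height_def)
  next
    case False
    then have "B \<inter> {..k} = (B - {x}) \<inter> {..k}" by auto
    then show ?thesis using False by (simp add: height_def)
  qed
  have 2: "height (insert y (B - {x})) k = height (B - {x}) k + of_bool (y \<le> k)"
    using assms by (simp add: height_def Int_insert_left)
  show ?thesis using 1 2 by simp
qed

lemma card_swap:
  assumes "finite B" "x \<in> B" "y \<notin> B"
  shows "card (insert y (B - {x})) = card B"
  using assms card_Suc_Diff1[of B x] by simp

text \<open>A swap of x and y moves the heights by one exactly between x and y, bringing A and B
  towards each other. If the difference of the heights has the right strict sign on that whole
  stretch, neither swapped set leaves the band between A and B. So y is taken where the run of
  strict sign adjacent to x ends.\<close>

lemma height_convex_symmetric_exchange:
  assumes hc: "height_convex n r \<B>" and A: "A \<in> \<B>" and B: "B \<in> \<B>" and x: "x \<in> A - B"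
  shows "\<exists>y\<in>B - A. insert y (A - {x}) \<in> \<B> \<and> insert x (B - {y}) \<in> \<B>"
proof -
  note bA = height_convex_basis[OF hc A] and bB = height_convex_basis[OF hc B]
  obtain x' where x': "x = Suc x'" "x \<le> n" using x bA(1) by (cases x) auto
  have hx: "height A x = Suc (height A x')" "height B x = height B x'"
    using x by (auto simp: x' height_Suc)
  have swap: ?thesis
    if y: "y \<in> B - A"
      and up: "\<And>k. x \<le> k \<Longrightarrow> k < y \<Longrightarrow> height B k < height A k"
      and down: "\<And>k. y \<le> k \<Longrightarrow> k < x \<Longrightarrow> height A k < height B k" for y
  proof (intro bexI[of _ y] conjI y)
    have sA: "height (insert y (A - {x})) k + of_bool (x \<le> k) = height A k + of_bool (y \<le> k)" for k
      using height_swap x y by blast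
    have sB: "height (insert x (B - {y})) k + of_bool (y \<le> k) = height B k + of_bool (x \<le> k)" for k
      using height_swap x y by blast
    show "insert y (A - {x}) \<in> \<B>"
    proof (rule height_convexD[OF hc A B])
      show "insert y (A - {x}) \<subseteq> {1..n}" using bA bB y by auto
      show "card (insert y (A - {x})) = r" using card_swap[of A x y] bA x y by simp
      show "min (height A k) (height B k) \<le> height (insert y (A - {x})) k"
        "height (insert y (A - {x})) k \<le> max (height A k) (height B k)" for k
        using sA[of k] up[of k] down[of k]
        by (cases "x \<le> k"; cases "y \<le> k"; simp add: not_le min_def max_def)+
    qed
    show "insert x (B - {y}) \<in> \<B>"
    proof (rule height_convexD[OF hc A B])
      show "insert x (B - {y}) \<subseteq> {1..n}" using bA bB x by auto
      show "card (insert x (B - {y})) = r" using card_swap[of B y x] bB x y by simp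
      show "min (height A k) (height B k) \<le> height (insert x (B - {y})) k"
        "height (insert x (B - {y})) k \<le> max (height A k) (height B k)" for k
        using sB[of k] up[of k] down[of k]
        by (cases "x \<le> k"; cases "y \<le> k"; simp add: not_le min_def max_def)+
    qed
  qed
  show ?thesis
  proof (cases "height B x' \<le> height A x'")
    case True
    \<comment> \<open>The step x belongs to A only, so A is strictly above B at x. Both heights
      equal r at n, so the gap closes at some first y, and it can only close by a step of B that A
      does not take.\<close>
    define y where "y = (LEAST y. x \<le> y \<and> height A y \<le> height B y)"
    have "x \<le> n \<and> height A n \<le> height B n"
      using x' bA bB by (simp add: height_ge[OF bA(1)] height_ge[OF bB(1)])
    from LeastI[of "\<lambda>y. x \<le> y \<and> height A y \<le> height B y", OF this]
    have y: "x \<le> y" "height A y \<le> height B y" by (auto simp: y_def)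
    have below: "height B k < height A k" if "x \<le> k" "k < y" for k
      using not_less_Least[of k "\<lambda>y. x \<le> y \<and> height A y \<le> height B y"] that
      unfolding y_def by auto
    have "x \<noteq> y" using y True hx by auto
    then obtain y' where y': "y = Suc y'" "x \<le> y'" using y by (cases y) auto
    have "y \<in> B - A"
      using below[of y'] y y' by (auto simp: height_Suc of_bool_def split: if_splits)
    then show ?thesis by (rule swap) (use below y in auto)
  next
    case False
    \<comment> \<open>Here A is strictly below B just before x, so the search runs backwards; 0 is a
      candidate because both heights vanish there. Right after j, B gets ahead of A, so
      \<open>Suc j\<close> lies in B only and serves as y.\<close>
    define j where "j = (GREATEST j. j \<le> x' \<and> height B j \<le> height A j)"
    have ex: "0 \<le> x' \<and> height B 0 \<le> height A 0"
      by (simp add: height_0[OF bA(1)] height_0[OF bB(1)])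
    have j: "j \<le> x'" "height B j \<le> height A j"
      using GreatestI_nat[of "\<lambda>j. j \<le> x' \<and> height B j \<le> height A j", OF ex]
      unfolding j_def by auto
    have above: "height A k < height B k" if "j < k" "k < x" for k
    proof (rule ccontr)
      assume "\<not> ?thesis"
      then have "k \<le> j"
        unfolding j_def using that x' by (intro Greatest_le_nat[where b = x']) auto
      then show False using that by simp
    qed
    have "j \<noteq> x'" using j False by auto
    then have "Suc j \<in> B - A"
      using above[of "Suc j"] j x' by (auto simp: height_Suc of_bool_def split: if_splits)
    then show ?thesis by (rule swap) (use above j x' in auto)
  qed
qed

section \<open>Joins, meets and extreme members of height-convex families\<close>

lemma set_of_height_function:
  assumes "g 0 = 0" and "\<And>k. g k \<le> g (Suc k)" and "\<And>k. g (Suc k) \<le> Suc (g k)"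
    and "\<And>k. n \<le> k \<Longrightarrow> g k = r"
  obtains C where "C \<subseteq> {1..n}" "card C = r" "\<And>k. height C k = g k"
proof -
  \<comment> \<open>The elements of C are the jumps of g. As all jumps have size one, counting them
    recovers g, and constancy from n on confines them to \<open>{1..n}\<close>.\<close>
  define C where "C = {k. 0 < k \<and> g (k - 1) < g k}"
  have h: "height C k = g k" for k
  proof (induction k)
    case 0
    have "C \<inter> {..0} = {}" by (auto simp: C_def)
    then show ?case using assms(1) by (simp add: height_def)
  next
    case (Suc k)
    have "g (Suc k) = g k + of_bool (g k < g (Suc k))"
      using assms(2)[of k] assms(3)[of k] by (auto simp: of_bool_def)
    then show ?case using Suc by (simp add: height_Suc C_def)
  qed
  have sub: "C \<subseteq> {1..n}"
  proof
    fix k assume k: "k \<in> C"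
    have "k \<le> n"
    proof (rule ccontr)
      assume "\<not> k \<le> n"
      then have "g (k - 1) = r" "g k = r" using assms(4) by auto
      with k show False by (simp add: C_def)
    qed
    then show "k \<in> {1..n}" using k by (auto simp: C_def)
  qed
  show ?thesis
    using that[OF sub _ h] height_ge[OF sub order_refl] h assms(4)[of n] by simp
qed

text \<open>The maximum and the minimum of two functions with increments 0 or 1 again have
  increments 0 or 1, so they are height functions of sets, which lie between A and B
  trivially.\<close>

lemma height_convex_lattice:
  assumes hc: "height_convex n r \<B>" and A: "A \<in> \<B>" and B: "B \<in> \<B>"
  shows "\<exists>C\<in>\<B>. \<forall>k. height C k = max (height A k) (height B k)" (is ?join)
    and "\<exists>C\<in>\<B>. \<forall>k. height C k = min (height A k) (height B k)" (is ?meet)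
proof -
  note bA = height_convex_basis[OF hc A] and bB = height_convex_basis[OF hc B]
  obtain C where C: "C \<subseteq> {1..n}" "card C = r" "\<And>k. height C k = max (height A k) (height B k)"
  proof (rule set_of_height_function[of "\<lambda>k. max (height A k) (height B k)" n r])
  qed (use bA bB in \<open>auto simp: height_0 height_ge height_Suc of_bool_def max_def\<close>)
  then have "C \<in> \<B>" by (intro height_convexD[OF hc A B]) auto
  then show ?join using C by blast
  obtain C where C: "C \<subseteq> {1..n}" "card C = r" "\<And>k. height C k = min (height A k) (height B k)"
  proof (rule set_of_height_function[of "\<lambda>k. min (height A k) (height B k)" n r])
  qed (use bA bB in \<open>auto simp: height_0 height_ge height_Suc of_bool_def min_def\<close>)
  then have "C \<in> \<B>" by (intro height_convexD[OF hc A B]) auto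
  then show ?meet using C by blast
qed

lemma height_convex_finite: "height_convex n r \<B> \<Longrightarrow> finite \<B>"
  by (rule finite_subset[of _ "Pow {1..n}"]) (auto simp: height_convex_def)

lemma height_convex_bounds:
  assumes hc: "height_convex n r \<B>" and ne: "\<B> \<noteq> {}"
  obtains L U where "L \<in> \<B>" "U \<in> \<B>"
    "\<And>B k. B \<in> \<B> \<Longrightarrow> height L k \<le> height B k" "\<And>B k. B \<in> \<B> \<Longrightarrow> height B k \<le> height U k"
proof -
  \<comment> \<open>The induction runs over arbitrary subfamilies, which need not be height-convex;
    the bounds are therefore only required to lie in \<B>.\<close>
  have fin: "finite \<A> \<Longrightarrow> \<A> \<noteq> {} \<Longrightarrow> \<A> \<subseteq> \<B> \<Longrightarrow>
      (\<exists>L\<in>\<B>. \<exists>U\<in>\<B>. \<forall>B\<in>\<A>. \<forall>k. height L k \<le> height B k \<and> height B k \<le> height U k)" for \<A>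
  proof (induction \<A> rule: finite_ne_induct)
    case (singleton B)
    then show ?case by auto
  next
    case (insert B \<A>)
    then obtain L U where LU: "L \<in> \<B>" "U \<in> \<B>"
      "\<forall>B\<in>\<A>. \<forall>k. height L k \<le> height B k \<and> height B k \<le> height U k" by auto
    obtain L' U' where "L' \<in> \<B>" "\<forall>k. height L' k = min (height L k) (height B k)"
      "U' \<in> \<B>" "\<forall>k. height U' k = max (height U k) (height B k)"
      using height_convex_lattice[OF hc] LU insert.prems by (metis insert_subset)
    then show ?case using LU(3)
      by (intro bexI[of _ L'] bexI[of _ U'])
        (auto intro: min.coboundedI1 max.coboundedI1)
  qed
  show ?thesis using fin[OF height_convex_finite[OF hc] ne order_refl] that by blast
qed

section \<open>Height-convex families as bases of lattice path matroids\<close>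

lemma count_North_path_of:
  assumes "B \<subseteq> {1..n}"
  shows "count_list (take k (path_of n B)) North = height B k"
proof (induction k)
  case 0
  then show ?case using assms by (simp add: height_0)
next
  case (Suc k)
  show ?case
  proof (cases "k < n")
    case True
    have len: "k < length (path_of n B)" using True by (simp add: path_of_def)
    have "path_of n B ! k = (if Suc k \<in> B then North else East)"
      using True by (simp add: path_of_def del: upt_Suc)
    then show ?thesis
      by (simp add: take_Suc_conv_app_nth[OF len] height_Suc Suc)
  next
    case False
    then have "take (Suc k) (path_of n B) = take k (path_of n B)" by (simp add: path_of_def)
    moreover have "Suc k \<notin> B" using False assms by auto
    ultimately show ?thesis using Suc by (simp add: height_Suc)
  qed
qed

lemma lattice_path_path_of:
  assumes "B \<subseteq> {1..m + r}" "card B = r"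
  shows "lattice_path m r (path_of (m + r) B)"
proof -
  have tot: "count_list p East + count_list p North = length p" for p
  proof (induction p)
    case (Cons s p)
    then show ?case by (cases s) auto
  qed simp
  have len: "length (path_of (m + r) B) = m + r" by (simp add: path_of_def del: upt_Suc)
  have "count_list (path_of (m + r) B) North = r"
    using count_North_path_of[OF assms(1), of "m + r"] height_ge[OF assms(1), of "m + r"] assms(2) len
    by simp
  with tot[of "path_of (m + r) B"] len show ?thesis by (simp add: lattice_path_def)
qed

lemma mem_lpm_bases_iff:
  "B \<in> lpm_bases m r P Q \<longleftrightarrow> B \<subseteq> {1..m + r} \<and> card B = r \<and>
     (\<forall>k. count_list (take k P) North \<le> height B k \<and> height B k \<le> count_list (take k Q) North)"
  unfolding lpm_bases_def never_above_def by (auto simp: count_North_path_of)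

lemma height_convex_lpm_bases: "height_convex (m + r) r (lpm_bases m r P Q)"
  unfolding height_convex_def
proof (intro conjI ballI allI impI)
  fix A B C
  assume A: "A \<in> lpm_bases m r P Q" and B: "B \<in> lpm_bases m r P Q"
    and C: "C \<subseteq> {1..m + r}" "card C = r"
      "\<forall>k. min (height A k) (height B k) \<le> height C k \<and>
         height C k \<le> max (height A k) (height B k)"
  have "count_list (take k P) North \<le> height C k \<and> height C k \<le> count_list (take k Q) North" for k
    using A B C(3) unfolding mem_lpm_bases_iff by (metis le_trans max.boundedI min.boundedI)
  then show "C \<in> lpm_bases m r P Q" using C by (simp add: mem_lpm_bases_iff)
qed (simp_all add: mem_lpm_bases_iff)

text \<open>The bounding paths are those of the least and the greatest member. Convexity applied to
  this one pair already returns every set in the region.\<close>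

lemma height_convex_imp_lpm_bases:
  assumes hc: "height_convex (m + r) r \<B>" and ne: "\<B> \<noteq> {}"
  shows "\<exists>P Q. lattice_path m r P \<and> lattice_path m r Q \<and> never_above P Q \<and>
    \<B> = lpm_bases m r P Q"
proof -
  obtain L U where LU: "L \<in> \<B>" "U \<in> \<B>"
    "\<And>B k. B \<in> \<B> \<Longrightarrow> height L k \<le> height B k" "\<And>B k. B \<in> \<B> \<Longrightarrow> height B k \<le> height U k"
    using height_convex_bounds[OF hc ne] by blast
  note b = height_convex_basis[OF hc]
  have "\<B> = lpm_bases m r (path_of (m + r) L) (path_of (m + r) U)"
  proof (intro set_eqI iffI)
    fix B assume "B \<in> \<B>"
    then show "B \<in> lpm_bases m r (path_of (m + r) L) (path_of (m + r) U)"
      using b LU by (simp add: mem_lpm_bases_iff count_North_path_of)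
  next
    fix B assume "B \<in> lpm_bases m r (path_of (m + r) L) (path_of (m + r) U)"
    then have "B \<subseteq> {1..m + r}" "card B = r"
      "\<And>k. height L k \<le> height B k \<and> height B k \<le> height U k"
      using b(1) LU(1,2) by (auto simp: mem_lpm_bases_iff count_North_path_of)
    then show "B \<in> \<B>"
      by (intro height_convexD[OF hc LU(1,2)]) (simp_all add: min.coboundedI1 max.coboundedI2)
  qed
  moreover have "never_above (path_of (m + r) L) (path_of (m + r) U)"
    using b LU by (simp add: never_above_def count_North_path_of)
  moreover have "lattice_path m r (path_of (m + r) L)" "lattice_path m r (path_of (m + r) U)"
    using lattice_path_path_of b LU(1,2) by auto
  ultimately show ?thesis by blast
qed

section \<open>Bases of maximal weight\<close>

definition max_weight :: "(nat \<Rightarrow> real) \<Rightarrow> nat set set \<Rightarrow> nat set set" where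
  "max_weight w \<B> = {B \<in> \<B>. \<forall>A\<in>\<B>. sum w A \<le> sum w B}"

text \<open>The two sets produced by a symmetric exchange change weight by opposite amounts. Neither
  may exceed the maximum, so both amounts are zero.\<close>

lemma max_weight_exchange:
  assumes hc: "height_convex n r \<B>" and A: "A \<in> max_weight w \<B>" and B: "B \<in> max_weight w \<B>"
    and x: "x \<in> A - B"
  shows "\<exists>y\<in>B - A. w y = w x \<and> insert y (A - {x}) \<in> max_weight w \<B>"
proof -
  have AB: "A \<in> \<B>" "B \<in> \<B>" using A B by (auto simp: max_weight_def)
  obtain y where y: "y \<in> B - A" "insert y (A - {x}) \<in> \<B>" "insert x (B - {y}) \<in> \<B>"
    using height_convex_symmetric_exchange[OF hc AB x] by blast
  have sums: "sum w (insert y (A - {x})) = sum w A - w x + w y"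
    "sum w (insert x (B - {y})) = sum w B - w y + w x"
    using x y height_convex_basis(3)[OF hc] AB by (simp_all add: sum_diff1)
  have max: "sum w S \<le> sum w A" "sum w S \<le> sum w B" if "S \<in> \<B>" for S
    using A B that by (auto simp: max_weight_def)
  have "w y = w x" using max(1)[OF y(2)] max(2)[OF y(3)] sums by linarith
  moreover have "insert y (A - {x}) \<in> max_weight w \<B>"
    unfolding max_weight_def using y(2) sums(1) max(1) \<open>w y = w x\<close> by simp
  ultimately show ?thesis using y(1) by blast
qed

lemma matroid_max_weight:
  assumes "height_convex n r \<B>" "max_weight w \<B> \<noteq> {}"
  shows "matroid {1..n} (max_weight w \<B>)"
  unfolding matroid_def
proof (intro conjI ballI assms(2))
  show "B \<subseteq> {1..n}" if "B \<in> max_weight w \<B>" for B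
    using that height_convex_basis(1)[OF assms(1)] by (simp add: max_weight_def)
  show "\<exists>y\<in>B - A. insert y (A - {x}) \<in> max_weight w \<B>"
    if "A \<in> max_weight w \<B>" "B \<in> max_weight w \<B>" "x \<in> A - B" for A B x
    using max_weight_exchange[OF assms(1) that] by blast
qed simp

text \<open>Exchanges lead from A to B, and each one replaces an element by another of equal weight.
  T is arbitrary because both single levels and the sets of all larger weights are needed
  later.\<close>

lemma card_weights_max_weight:
  assumes hc: "height_convex n r \<B>" and B: "B \<in> max_weight w \<B>" and A: "A \<in> max_weight w \<B>"
  shows "card (A \<inter> w -` T) = card (B \<inter> w -` T)"
  using A
proof (induction "card (A - B)" arbitrary: A rule: less_induct)
  case less
  have AB: "A \<in> \<B>" "B \<in> \<B>" using less.prems B by (auto simp: max_weight_def)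
  note bA = height_convex_basis[OF hc AB(1)] and bB = height_convex_basis[OF hc AB(2)]
  show ?case
  proof (cases "A \<subseteq> B")
    case True
    then have "A = B" using card_subset_eq[OF bB(3) True] bA bB by simp
    then show ?thesis by simp
  next
    case False
    then obtain x where x: "x \<in> A - B" by auto
    obtain y where y: "y \<in> B - A" "w y = w x" "insert y (A - {x}) \<in> max_weight w \<B>"
      using max_weight_exchange[OF hc less.prems B x] by blast
    have "insert y (A - {x}) - B \<subset> A - B" using x y(1) by auto
    then have "card (insert y (A - {x}) \<inter> w -` T) = card (B \<inter> w -` T)"
      using less.hyps y(3) bA(3) by (simp add: psubset_card_mono)
    moreover have "card (insert y (A - {x}) \<inter> w -` T) = card (A \<inter> w -` T)"
    proof (cases "w x \<in> T")
      case True
      then have "insert y (A - {x}) \<inter> w -` T = insert y ((A \<inter> w -` T) - {x})" using y by auto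
      then show ?thesis using card_swap[of "A \<inter> w -` T" x y] x y bA True by simp
    next
      case False
      then have "insert y (A - {x}) \<inter> w -` T = A \<inter> w -` T" using y by auto
      then show ?thesis by simp
    qed
    ultimately show ?thesis by simp
  qed
qed

text \<open>Exchange only elements x with weight in T: the incoming y has the same weight, so the
  rest of A stays untouched. When the T-part of A is contained in B, the equal counts force it to be
  the T-part of B.\<close>

lemma max_weight_replace_weights:
  assumes hc: "height_convex n r \<B>" and B: "B \<in> max_weight w \<B>" and A: "A \<in> max_weight w \<B>"
  shows "(A - w -` T) \<union> (B \<inter> w -` T) \<in> max_weight w \<B>"
  using A
proof (induction "card (A \<inter> w -` T - B)" arbitrary: A rule: less_induct)
  case less
  have AB: "A \<in> \<B>" "B \<in> \<B>" using less.prems B by (auto simp: max_weight_def)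
  note bA = height_convex_basis[OF hc AB(1)] and bB = height_convex_basis[OF hc AB(2)]
  show ?case
  proof (cases "A \<inter> w -` T \<subseteq> B")
    case True
    then have "A \<inter> w -` T = B \<inter> w -` T"
      using card_weights_max_weight[OF hc B less.prems, of T] bB
      by (intro card_subset_eq) auto
    then have "(A - w -` T) \<union> (B \<inter> w -` T) = A" by blast
    then show ?thesis using less.prems by simp
  next
    case False
    then obtain x where x: "x \<in> A - B" "w x \<in> T" by blast
    obtain y where y: "y \<in> B - A" "w y = w x" "insert y (A - {x}) \<in> max_weight w \<B>"
      using max_weight_exchange[OF hc less.prems B x(1)] by blast
    have "insert y (A - {x}) \<inter> w -` T - B \<subset> A \<inter> w -` T - B" using x y(1) by auto
    then have "(insert y (A - {x}) - w -` T) \<union> (B \<inter> w -` T) \<in> max_weight w \<B>"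
      using less.hyps y(3) bA(3) by (simp add: psubset_card_mono)
    moreover have "insert y (A - {x}) - w -` T = A - w -` T" using x y by auto
    ultimately show ?thesis by simp
  qed
qed

text \<open>Induction on the set T of levels at which A has already been replaced by C.\<close>

lemma max_weight_if_sandwiched_in_levels:
  assumes hc: "height_convex n r \<B>" and A: "A \<in> max_weight w \<B>" and B: "B \<in> max_weight w \<B>"
    and C: "C \<subseteq> {1..n}"
    and level: "\<And>c. card (C \<inter> w -` {c}) = card (A \<inter> w -` {c})"
    and lower: "\<And>c k. min (height (A \<inter> w -` {c}) k) (height (B \<inter> w -` {c}) k) \<le> height (C \<inter> w -` {c}) k"
    and upper: "\<And>c k. height (C \<inter> w -` {c}) k \<le> max (height (A \<inter> w -` {c}) k) (height (B \<inter> w -` {c}) k)"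
  shows "C \<in> max_weight w \<B>"
proof -
  have finC: "finite C" using C finite_subset by blast
  have "finite T \<Longrightarrow> (A - w -` T) \<union> (C \<inter> w -` T) \<in> max_weight w \<B>" for T
  proof (induction T rule: finite_induct)
    case empty
    then show ?case using A by simp
  next
    case (insert c T)
    let ?L = "w -` {c}"
    \<comment> \<open>D, X and Y agree outside level c and carry there the level of A, B and C
      respectively. Heights add over disjoint unions, so the sandwich at level c puts Y between D
      and X.\<close>
    define D where "D = (A - w -` T) \<union> (C \<inter> w -` T)"
    define X where "X = (D - ?L) \<union> (B \<inter> ?L)"
    define Y where "Y = (D - ?L) \<union> (C \<inter> ?L)"
    have D: "D \<in> max_weight w \<B>" using insert.IH by (simp add: D_def)
    then have X: "X \<in> max_weight w \<B>"
      unfolding X_def using max_weight_replace_weights[OF hc B] by blast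
    have DX: "D \<in> \<B>" "X \<in> \<B>" using D X by (auto simp: max_weight_def)
    note bD = height_convex_basis[OF hc DX(1)]
    have DL: "D \<inter> ?L = A \<inter> ?L" using insert.hyps by (auto simp: D_def)
    have D_split: "D = (D - ?L) \<union> (A \<inter> ?L)" using DL by blast
    have disj: "(D - ?L) \<inter> (S \<inter> ?L) = {}" for S by blast
    have hY: "height Y k = height (D - ?L) k + height (C \<inter> ?L) k"
      and hX: "height X k = height (D - ?L) k + height (B \<inter> ?L) k" for k
      unfolding X_def Y_def by (rule height_union[OF disj])+
    have hD: "height D k = height (D - ?L) k + height (A \<inter> ?L) k" for k
      by (subst D_split) (rule height_union[OF disj])
    have cY: "card Y = card D"
    proof -
      have "card Y = card (D - ?L) + card (C \<inter> ?L)"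
        unfolding Y_def using bD finC by (intro card_Un_disjoint) auto
      also have "\<dots> = card (D - ?L) + card (D \<inter> ?L)" using level DL by simp
      also have "\<dots> = card D"
        using bD by (subst card_Un_disjoint[symmetric]) (auto intro: arg_cong[of _ _ card])
      finally show ?thesis .
    qed
    have "Y \<in> \<B>"
    proof (rule height_convexD[OF hc DX])
      show "Y \<subseteq> {1..n}" using bD C by (auto simp: Y_def)
      show "card Y = r" using cY bD by simp
      show "min (height D k) (height X k) \<le> height Y k"
        "height Y k \<le> max (height D k) (height X k)" for k
        using lower[of c k] upper[of c k] unfolding hD hX hY by auto
    qed
    moreover have "sum w Y = sum w D"
    proof -
      have const: "sum w (S \<inter> ?L) = real (card (S \<inter> ?L)) * c" for S
        by (subst sum_constant[symmetric]) (auto intro: sum.cong)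
      have "sum w Y = sum w (D - ?L) + sum w (C \<inter> ?L)"
        unfolding Y_def using bD finC by (intro sum.union_disjoint) auto
      also have "\<dots> = sum w (D - ?L) + sum w (D \<inter> ?L)" by (simp add: const level DL)
      also have "\<dots> = sum w D"
        using bD by (subst sum.union_disjoint[symmetric]) (auto intro: sum.cong)
      finally show ?thesis .
    qed
    ultimately have "Y \<in> max_weight w \<B>" using D by (simp add: max_weight_def)
    moreover have "Y = (A - w -` insert c T) \<union> (C \<inter> w -` insert c T)"
      using insert.hyps by (auto simp: Y_def D_def)
    ultimately show ?case by simp
  qed
  \<comment> \<open>Once T contains every weight of A and C, nothing of A is left over and all of C
    is present.\<close>
  from this[of "w ` (A \<union> C)"] show ?thesis
  proof -
    assume "finite (w ` (A \<union> C)) \<Longrightarrow>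
      (A - w -` w ` (A \<union> C)) \<union> (C \<inter> w -` w ` (A \<union> C)) \<in> max_weight w \<B>"
    moreover have "finite A" using A height_convex_basis[OF hc] by (auto simp: max_weight_def)
    moreover have "(A - w -` w ` (A \<union> C)) \<union> (C \<inter> w -` w ` (A \<union> C)) = C" by auto
    ultimately show ?thesis using finC by simp
  qed
qed

section \<open>Sorting the ground set by decreasing weight\<close>

definition precedes :: "(nat \<Rightarrow> real) \<Rightarrow> nat \<Rightarrow> nat \<Rightarrow> bool" where
  "precedes w j i \<longleftrightarrow> w i < w j \<or> (w j = w i \<and> j \<le> i)"

text \<open>Since \<open>precedes\<close> is reflexive, each element counts itself and the ranks
  start at 1.\<close>

definition weight_rank :: "nat \<Rightarrow> (nat \<Rightarrow> real) \<Rightarrow> nat \<Rightarrow> nat" where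
  "weight_rank n w i = card {j \<in> {1..n}. precedes w j i}"

text \<open>D is an initial segment of the sorted order. An element outside D is preceded by all of
  D and by itself, while one inside D has all its predecessors in D.\<close>

lemma weight_rank_le_card_iff:
  assumes D: "D \<subseteq> {1..n}" and down: "\<And>i j. i \<in> D \<Longrightarrow> j \<in> {1..n} \<Longrightarrow> precedes w j i \<Longrightarrow> j \<in> D"
    and j: "j \<in> {1..n}"
  shows "weight_rank n w j \<le> card D \<longleftrightarrow> j \<in> D"
proof
  have finD: "finite D" using D finite_subset by blast
  assume le: "weight_rank n w j \<le> card D"
  show "j \<in> D"
  proof (rule ccontr)
    assume nj: "j \<notin> D"
    have "precedes w i j" if "i \<in> D" for i
    proof -
      have "\<not> precedes w j i" using down[OF that j] nj by blast
      then show ?thesis unfolding precedes_def by linarith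
    qed
    then have "insert j D \<subseteq> {i \<in> {1..n}. precedes w i j}"
      using D j by (auto simp: precedes_def)
    then have "card (insert j D) \<le> weight_rank n w j"
      unfolding weight_rank_def by (intro card_mono) auto
    then show False using le nj finD by simp
  qed
next
  assume "j \<in> D"
  then have "{i \<in> {1..n}. precedes w i j} \<subseteq> D" using down by blast
  then show "weight_rank n w j \<le> card D"
    unfolding weight_rank_def using D finite_subset by (intro card_mono) auto
qed

lemma bij_betw_weight_rank: "bij_betw (weight_rank n w) {1..n} {1..n}"
proof -
  have "inj_on (weight_rank n w) {1..n}"
  proof (rule linorder_inj_onI')
    fix i j assume ij: "i \<in> {1..n}" "j \<in> {1..n}" "i < j"
    have "weight_rank n w k < weight_rank n w l"
      if "l \<in> {1..n}" "precedes w k l" "\<not> precedes w l k" for k l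
      unfolding weight_rank_def
      by (rule psubset_card_mono) (use that in \<open>auto simp: precedes_def\<close>)
    then show "weight_rank n w i \<noteq> weight_rank n w j"
      using ij by (metis less_irrefl less_le_not_le linorder_neqE precedes_def)
  qed
  moreover have "weight_rank n w i \<in> {1..n}" if "i \<in> {1..n}" for i
  proof -
    have "{i} \<subseteq> {j \<in> {1..n}. precedes w j i}" using that by (auto simp: precedes_def)
    from card_mono[OF _ this] have "1 \<le> weight_rank n w i" by (simp add: weight_rank_def)
    moreover have "weight_rank n w i \<le> card {1..n}"
      unfolding weight_rank_def by (intro card_mono) auto
    ultimately show ?thesis by simp
  qed
  ultimately show ?thesis
    by (simp add: bij_betw_def endo_inj_surj image_subset_iff)
qed

text \<open>Turns heights after sorting into counts in the original ground set, one for each initial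
  segment D.\<close>

lemma height_weight_rank_image:
  assumes D: "D \<subseteq> {1..n}" and down: "\<And>i j. i \<in> D \<Longrightarrow> j \<in> {1..n} \<Longrightarrow> precedes w j i \<Longrightarrow> j \<in> D"
    and C: "C \<subseteq> {1..n}"
  shows "height (weight_rank n w ` C) (card D) = card (C \<inter> D)"
proof -
  have "weight_rank n w j \<le> card D \<longleftrightarrow> j \<in> D" if "j \<in> {1..n}" for j
    using D down that by (rule weight_rank_le_card_iff)
  then have "weight_rank n w ` C \<inter> {..card D} = weight_rank n w ` (C \<inter> D)"
    using C by blast
  moreover have "inj_on (weight_rank n w) (C \<inter> D)"
    using bij_betw_weight_rank C by (meson bij_betw_def inj_on_subset le_infI1)
  ultimately show ?thesis by (simp add: height_def card_image)
qed

text \<open>Breaking ties by position keeps the original order inside each weight level, so a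
  sandwich after sorting can be transferred back to the levels.\<close>

lemma height_convex_weight_rank_image:
  assumes hc: "height_convex n r \<B>"
  shows "height_convex n r (image (weight_rank n w) ` max_weight w \<B>)"
proof -
  let ?\<pi> = "weight_rank n w"
  have inj: "inj_on ?\<pi> {1..n}" and img: "?\<pi> ` {1..n} = {1..n}"
    using bij_betw_weight_rank by (auto simp: bij_betw_def)
  have basis: "B \<subseteq> {1..n}" "card B = r" if "B \<in> max_weight w \<B>" for B
    using that height_convex_basis[OF hc] by (auto simp: max_weight_def)
  have card_img: "card (?\<pi> ` B) = card B" if "B \<subseteq> {1..n}" for B
    using inj that by (meson card_image inj_on_subset)
  have sandwich: "?\<pi> ` C \<in> image ?\<pi> ` max_weight w \<B>"
    if A: "A \<in> max_weight w \<B>" and B: "B \<in> max_weight w \<B>" and C: "C \<subseteq> {1..n}"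
      and sw: "\<And>k. min (height (?\<pi> ` A) k) (height (?\<pi> ` B) k) \<le> height (?\<pi> ` C) k \<and>
        height (?\<pi> ` C) k \<le> max (height (?\<pi> ` A) k) (height (?\<pi> ` B) k)" for A B C
  proof -
    have down_sw: "min (card (A \<inter> D)) (card (B \<inter> D)) \<le> card (C \<inter> D) \<and>
        card (C \<inter> D) \<le> max (card (A \<inter> D)) (card (B \<inter> D))"
      if D: "D \<subseteq> {1..n}"
        and down: "\<And>i j. i \<in> D \<Longrightarrow> j \<in> {1..n} \<Longrightarrow> precedes w j i \<Longrightarrow> j \<in> D" for D
    proof -
      have "height (?\<pi> ` S) (card D) = card (S \<inter> D)" if "S \<subseteq> {1..n}" for S
        using D down that by (rule height_weight_rank_image)
      then show ?thesis using sw[of "card D"] basis(1)[OF A] basis(1)[OF B] C by simp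
    qed
    \<comment> \<open>A level up to position \<open>k\<close> is the difference of two sets that are initial in the sorted order,
      and the smaller of these meets \<open>A\<close> and \<open>B\<close> in equally many elements.\<close>
    have level_sw: "min (height (A \<inter> w -` {c}) k) (height (B \<inter> w -` {c}) k) \<le> height (C \<inter> w -` {c}) k \<and>
        height (C \<inter> w -` {c}) k \<le> max (height (A \<inter> w -` {c}) k) (height (B \<inter> w -` {c}) k)" for c k
    proof -
      define U where "U = {1..n} \<inter> w -` {c<..}"
      define D where "D = U \<union> ({1..n} \<inter> w -` {c} \<inter> {..k})"
      have split: "card (S \<inter> D) = card (S \<inter> U) + height (S \<inter> w -` {c}) k" if "S \<subseteq> {1..n}" for S
      proof -
        have "S \<inter> D = (S \<inter> U) \<union> (S \<inter> w -` {c} \<inter> {..k})"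
          using that by (auto simp: D_def)
        moreover have "finite S" using that finite_subset by blast
        ultimately show ?thesis
          unfolding height_def by (simp add: card_Un_disjoint U_def disjoint_iff)
      qed
      have U: "min (card (A \<inter> U)) (card (B \<inter> U)) \<le> card (C \<inter> U) \<and>
          card (C \<inter> U) \<le> max (card (A \<inter> U)) (card (B \<inter> U))"
        by (rule down_sw) (auto simp: U_def precedes_def)
      have D: "min (card (A \<inter> D)) (card (B \<inter> D)) \<le> card (C \<inter> D) \<and>
          card (C \<inter> D) \<le> max (card (A \<inter> D)) (card (B \<inter> D))"
        by (rule down_sw) (auto simp: U_def D_def precedes_def)
      have "S \<inter> U = S \<inter> w -` {c<..}" if "S \<subseteq> {1..n}" for S using that by (auto simp: U_def)
      then have "card (A \<inter> U) = card (B \<inter> U)"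
        using card_weights_max_weight[OF hc B A] basis(1)[OF A] basis(1)[OF B] by simp
      then show ?thesis using U D split basis(1)[OF A] basis(1)[OF B] C by auto
    qed
    \<comment> \<open>At position n the heights are the full level sizes. These agree for A and B,
      so minimum and maximum coincide and determine the size for C.\<close>
    have "card (C \<inter> w -` {c}) = card (A \<inter> w -` {c})" for c
    proof -
      have "height (S \<inter> w -` {c}) n = card (S \<inter> w -` {c})" if "S \<subseteq> {1..n}" for S
        using that by (intro height_ge) auto
      then show ?thesis
        using level_sw[of c n] card_weights_max_weight[OF hc B A] basis(1)[OF A] basis(1)[OF B] C
        by simp
    qed
    then have "C \<in> max_weight w \<B>"
      using max_weight_if_sandwiched_in_levels[OF hc A B C] level_sw by blast
    then show ?thesis by blast
  qed
  show ?thesis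
    unfolding height_convex_def
  proof (intro conjI ballI allI impI)
    fix S assume "S \<in> image ?\<pi> ` max_weight w \<B>"
    then obtain B where B: "B \<in> max_weight w \<B>" "S = ?\<pi> ` B" by blast
    show "S \<subseteq> {1..n}" using basis(1)[OF B(1)] img B(2) by blast
    show "card S = r" using basis[OF B(1)] card_img B(2) by simp
  next
    fix S T C'
    assume "S \<in> image ?\<pi> ` max_weight w \<B>" "T \<in> image ?\<pi> ` max_weight w \<B>"
      and C': "C' \<subseteq> {1..n}" "\<forall>k. min (height S k) (height T k) \<le> height C' k \<and>
        height C' k \<le> max (height S k) (height T k)"
    then obtain A B where "A \<in> max_weight w \<B>" "S = ?\<pi> ` A" "B \<in> max_weight w \<B>" "T = ?\<pi> ` B"
      by blast
    moreover obtain C where "C \<subseteq> {1..n}" "C' = ?\<pi> ` C"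
      using C'(1) img by (metis subset_image_iff)
    ultimately show "C' \<in> image ?\<pi> ` max_weight w \<B>"
      using sandwich[of A B C] C'(2) by simp
  qed
qed

text \<open>The isomorphism is the sorting permutation. The bounding paths may change, but their
  common endpoint (m, r) does not.\<close>

lemma lattice_path_matroid_max_weight:
  assumes hc: "height_convex (m + r) r \<B>" and ne: "max_weight w \<B> \<noteq> {}"
  shows "lattice_path_matroid {1..m + r} (max_weight w \<B>)"
proof -
  let ?\<pi> = "weight_rank (m + r) w"
  obtain P Q where PQ: "lattice_path m r P" "lattice_path m r Q" "never_above P Q"
    "image ?\<pi> ` max_weight w \<B> = lpm_bases m r P Q"
    using height_convex_imp_lpm_bases[OF height_convex_weight_rank_image[OF hc, of w]] ne by auto
  have bij: "bij_betw ?\<pi> {1..m + r} {1..m + r}" by (rule bij_betw_weight_rank)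
  have "B \<in> max_weight w \<B> \<longleftrightarrow> ?\<pi> ` B \<in> image ?\<pi> ` max_weight w \<B>" if "B \<subseteq> {1..m + r}" for B
    using that bij height_convex_basis(1)[OF hc]
    by (auto simp: bij_betw_def max_weight_def inj_on_image_eq_iff)
  then have "matroid_iso {1..m + r} (max_weight w \<B>) {1..m + r} (lpm_bases m r P Q)"
    unfolding matroid_iso_def PQ(4)[symmetric] using bij by blast
  then show ?thesis
    unfolding lattice_path_matroid_def using matroid_max_weight[OF hc ne] PQ by blast
qed

section \<open>Faces of the polytope as polytopes of maximal-weight bases\<close>

lemma face_of_matroid_polytope:
  fixes e :: "nat \<Rightarrow> 'a::euclidean_space"
  assumes fin: "finite \<B>" and F: "F face_of matroid_polytope e \<B>" and ne: "F \<noteq> {}"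
  shows "\<exists>w. max_weight w \<B> \<noteq> {} \<and> F = matroid_polytope e (max_weight w \<B>)"
proof -
  define V where "V = {\<Sum>i\<in>B. e i | B. B \<in> \<B>}"
  have V: "V = (\<lambda>B. \<Sum>i\<in>B. e i) ` \<B>" by (auto simp: V_def)
  have F': "F face_of convex hull V" using F by (simp add: matroid_polytope_def V_def)
  have "finite V" using fin V by simp
  \<comment> \<open>Faces of a polytope are exposed; the normal vector a may be 0, which covers the
    whole polytope.\<close>
  then have "F exposed_face_of convex hull V"
    using F' by (simp add: exposed_face_of_polyhedron polytope_imp_polyhedron polytope_convex_hull)
  then obtain a b where ab: "convex hull V \<subseteq> {x. a \<bullet> x \<le> b}"
    "F = convex hull V \<inter> {x. a \<bullet> x = b}"
    by (auto simp: exposed_face_of_def)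
  \<comment> \<open>F is nonempty and spanned by some of the generators, so it contains one of them;
    hence the bound b is attained by a basis and is the maximal weight.\<close>
  obtain S where S: "S \<subseteq> V" "F = convex hull S"
    using face_of_convex_hull_subset[OF finite_imp_compact[OF \<open>finite V\<close>] F'] by blast
  \<comment> \<open>The weights are the values of the exposing functional on the vectors
    \<open>e i\<close>, so the weight of a basis is the value of the functional at its
    generator.\<close>
  define w where "w = (\<lambda>i. a \<bullet> e i)"
  have w: "a \<bullet> (\<Sum>i\<in>B. e i) = sum w B" for B by (simp add: w_def inner_sum_right)
  have le: "sum w B \<le> b" if "B \<in> \<B>" for B
    using ab(1) hull_inc[of "\<Sum>i\<in>B. e i" V convex] that w[of B] V by auto
  have "S \<noteq> {}" using ne S by auto
  then obtain B where B: "B \<in> \<B>" "(\<Sum>i\<in>B. e i) \<in> S" using S V by auto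
  then have "(\<Sum>i\<in>B. e i) \<in> F" using S hull_inc by metis
  then have Bb: "sum w B = b" using ab(2) w by auto
  then have mw: "max_weight w \<B> = {B \<in> \<B>. sum w B = b}"
    using B le by (force simp: max_weight_def)
  have "F = convex hull (V \<inter> F)"
  proof
    have "S \<subseteq> V \<inter> F" using S hull_subset[of S convex] by auto
    from hull_mono[OF this, of convex] show "F \<subseteq> convex hull (V \<inter> F)" using S by simp
    show "convex hull (V \<inter> F) \<subseteq> F"
      using F' by (intro hull_minimal) (auto dest: face_of_imp_convex)
  qed
  also have "V \<inter> F = {\<Sum>i\<in>B. e i | B. B \<in> max_weight w \<B>}"
    unfolding ab(2) mw using w hull_subset[of V convex] by (auto simp: V)
  finally have "F = matroid_polytope e (max_weight w \<B>)" unfolding matroid_polytope_def .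
  moreover have "max_weight w \<B> \<noteq> {}" using B Bb mw by blast
  ultimately show ?thesis by blast
qed

(* The vectors e 1, ..., e (m + r) are distinct standard basis vectors, so their span is a copy of
   R^(m + r). Requiring only a subset of Basis, rather than all of it, keeps the case m + r = 0,
   because every type of class euclidean_space has positive dimension.
   The library counts the empty set as a face; it is excluded, as matroid polytopes are nonempty. *)
theorem mainTheorem6:
  fixes m r :: nat
    and P Q :: "step list"
    and e :: "nat \<Rightarrow> 'a::euclidean_space"
    and F :: "'a set"
  assumes "lattice_path m r P"
    and "lattice_path m r Q"
    and "never_above P Q"
    and "inj_on e {1..m + r}"
    and "e ` {1..m + r} \<subseteq> Basis"
    and "F face_of matroid_polytope e (lpm_bases m r P Q)"
    and "F \<noteq> {}"
  shows "\<exists>\<B>. lattice_path_matroid {1..m + r} \<B> \<and> F = matroid_polytope e \<B>"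
proof -
  have hc: "height_convex (m + r) r (lpm_bases m r P Q)" by (rule height_convex_lpm_bases)
  obtain w where "max_weight w (lpm_bases m r P Q) \<noteq> {}"
    "F = matroid_polytope e (max_weight w (lpm_bases m r P Q))"
    using face_of_matroid_polytope[OF height_convex_finite[OF hc]] assms by blast
  then show ?thesis using lattice_path_matroid_max_weight[OF hc] by blast
qed

end
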